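(* Suppose $n\geqslant 5$. Let $\rho:WB_n\to GL_r(\mathbb{C})$ be an $r$-dimensional representation of the welded braid group $WB_n$, where $2\leqslant r\leqslant n-2$. Then $\rho$ is reducible.
   Context: The welded braid group $WB_n$ is the group generated by $\alpha_1,\dots,\alpha_{n-1},\sigma_1,\dots,\sigma_{n-1}$ with defining relations: $\alpha_i^2=1$ ($1\leqslant i\leqslant n-1$); $\alpha_i\alpha_j=\alpha_j\alpha_i$, $\sigma_i\sigma_j=\sigma_j\sigma_i$, $\alpha_i\sigma_j=\sigma_j\alpha_i$ for $|i-j|\geqslant 2$; and, for $1\leqslant i\leqslant n-2$, $\alpha_i\alpha_{i+1}\alpha_i=\alpha_{i+1}\alpha_i\alpha_{i+1}$, $\sigma_i\sigma_{i+1}\sigma_i=\sigma_{i+1}\sigma_i\sigma_{i+1}$, $\alpha_i\alpha_{i+1}\sigma_i=\sigma_{i+1}\alpha_i\alpha_{i+1}$, $\sigma_i\sigma_{i+1}\alpha_i=\alpha_{i+1}\sigma_i\sigma_{i+1}$. *)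

theory Defs
  imports "HOL-Analysis.Analysis" "HOL-Algebra.Generated_Groups"
begin

text \<open>A word over a set \<open>S\<close> of generators is a list of letters \<open>(x, b)\<close>, where \<open>(x, True)\<close> stands
  for \<open>x\<close> and \<open>(x, False)\<close> for its formal inverse. A pair \<open>(l, r)\<close> in \<open>R\<close> is the relation \<open>l = r\<close>.
  The presented group consists of the words modulo the congruence generated by \<open>R\<close> together with
  the free cancellations.\<close>

type_synonym 'a word = "('a \<times> bool) list"

definition words :: "'a set \<Rightarrow> 'a word set" where
  "words S = lists (S \<times> UNIV)"

inductive_set word_cong :: "'a set \<Rightarrow> ('a word \<times> 'a word) set \<Rightarrow> ('a word \<times> 'a word) set"
  for S :: "'a set" and R :: "('a word \<times> 'a word) set" where
  refl: "u \<in> words S \<Longrightarrow> (u, u) \<in> word_cong S R"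
| sym: "(u, v) \<in> word_cong S R \<Longrightarrow> (v, u) \<in> word_cong S R"
| trans: "(u, v) \<in> word_cong S R \<Longrightarrow> (v, w) \<in> word_cong S R \<Longrightarrow> (u, w) \<in> word_cong S R"
| cancel: "u \<in> words S \<Longrightarrow> v \<in> words S \<Longrightarrow> x \<in> S
    \<Longrightarrow> (u @ [(x, b), (x, \<not> b)] @ v, u @ v) \<in> word_cong S R"
| rel: "u \<in> words S \<Longrightarrow> v \<in> words S \<Longrightarrow> (l, r) \<in> R \<Longrightarrow> l \<in> words S \<Longrightarrow> r \<in> words S
    \<Longrightarrow> (u @ l @ v, u @ r @ v) \<in> word_cong S R"

definition presented_group :: "'a set \<Rightarrow> ('a word \<times> 'a word) set \<Rightarrow> 'a word set monoid" where
  "presented_group S R =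
    \<lparr>carrier = words S // word_cong S R,
     mult = (\<lambda>X Y. \<Union>u\<in>X. \<Union>v\<in>Y. word_cong S R `` {u @ v}),
     one = word_cong S R `` {[]}\<rparr>"

lemma word_cong_words:
  "(u, v) \<in> word_cong S R \<Longrightarrow> u \<in> words S \<and> v \<in> words S"
  by (induction rule: word_cong.induct) (auto simp: words_def)

lemma equiv_word_cong: "equiv (words S) (word_cong S R)"
proof (rule equivI)
  show "word_cong S R \<subseteq> words S \<times> words S"
    by (auto dest: word_cong_words)
  show "refl_on (words S) (word_cong S R)"
    by (auto simp: refl_on_def intro: word_cong.refl)
  show "Relation.sym (word_cong S R)"
    by (auto simp: sym_def intro: word_cong.sym)
  show "Relation.trans (word_cong S R)"
    by (auto simp: trans_def intro: word_cong.trans)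
qed

lemma word_cong_context:
  assumes "(u, v) \<in> word_cong S R" "p \<in> words S" "q \<in> words S"
  shows "(p @ u @ q, p @ v @ q) \<in> word_cong S R"
  using assms
proof (induction rule: word_cong.induct)
  case (refl u)
  then show ?case by (auto simp: words_def intro!: word_cong.refl)
next
  case (sym u v)
  then show ?case by (blast intro: word_cong.sym)
next
  case (trans u v w)
  then show ?case by (blast intro: word_cong.trans)
next
  case (cancel u v x b)
  then have "((p @ u) @ [(x, b), (x, \<not> b)] @ (v @ q), (p @ u) @ (v @ q)) \<in> word_cong S R"
    by (intro word_cong.cancel) (auto simp: words_def)
  then show ?case by simp
next
  case (rel u v l r)
  then have "((p @ u) @ l @ (v @ q), (p @ u) @ r @ (v @ q)) \<in> word_cong S R"
    by (intro word_cong.rel) (auto simp: words_def)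
  then show ?case by simp
qed

lemma word_cong_append:
  assumes "(u, u') \<in> word_cong S R" "(v, v') \<in> word_cong S R"
  shows "(u @ v, u' @ v') \<in> word_cong S R"
proof -
  have "(u @ v, u' @ v) \<in> word_cong S R"
    using word_cong_context[OF assms(1), of "[]" v] word_cong_words[OF assms(2)]
    by (simp add: words_def)
  moreover have "(u' @ v, u' @ v') \<in> word_cong S R"
    using word_cong_context[OF assms(2), of u' "[]"] word_cong_words[OF assms(1)]
    by (simp add: words_def)
  ultimately show ?thesis by (rule word_cong.trans)
qed

lemma presented_group_mult:
  assumes "u \<in> words S" "v \<in> words S"
  shows "(word_cong S R `` {u}) \<otimes>\<^bsub>presented_group S R\<^esub> (word_cong S R `` {v})
       = word_cong S R `` {u @ v}"
proof -
  have c: "(\<lambda>u v. word_cong S R `` {u @ v}) respects2 word_cong S R"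
    by (rule congruent2I')
      (metis equiv_class_eq[OF equiv_word_cong] word_cong_append)
  show ?thesis
    using UN_equiv_class2[OF equiv_word_cong equiv_word_cong c assms]
    by (simp add: presented_group_def)
qed

lemma word_cong_inverse:
  "u \<in> words S \<Longrightarrow> (rev (map (\<lambda>(x, b). (x, \<not> b)) u) @ u, []) \<in> word_cong S R"
proof (induction u)
  case Nil
  then show ?case by (simp add: word_cong.refl words_def)
next
  case (Cons a u)
  obtain x b where a: "a = (x, b)" by fastforce
  let ?i = "rev (map (\<lambda>(x, b). (x, \<not> b)) u)"
  have i: "?i \<in> words S" "u \<in> words S" "x \<in> S"
    using Cons.prems by (auto simp: words_def a)
  have "(?i @ [(x, \<not> b), (x, \<not> \<not> b)] @ u, ?i @ u) \<in> word_cong S R"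
    using i by (intro word_cong.cancel)
  with Cons.IH i show ?case by (auto simp: a intro: word_cong.trans)
qed

lemma group_presented_group: "group (presented_group S R)"
proof (rule groupI)
  let ?G = "presented_group S R"
  have car: "carrier ?G = (\<lambda>u. word_cong S R `` {u}) ` words S"
    by (auto simp: presented_group_def quotient_def)
  have one: "\<one>\<^bsub>?G\<^esub> = word_cong S R `` {[]}"
    by (simp add: presented_group_def)
  show "\<one>\<^bsub>?G\<^esub> \<in> carrier ?G"
    by (auto simp: car one words_def)
  show "X \<otimes>\<^bsub>?G\<^esub> Y \<in> carrier ?G" if "X \<in> carrier ?G" "Y \<in> carrier ?G" for X Y
    using that by (auto simp: car presented_group_mult) (auto simp: words_def)
  show "X \<otimes>\<^bsub>?G\<^esub> Y \<otimes>\<^bsub>?G\<^esub> Z = X \<otimes>\<^bsub>?G\<^esub> (Y \<otimes>\<^bsub>?G\<^esub> Z)"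
    if XYZ: "X \<in> carrier ?G" "Y \<in> carrier ?G" "Z \<in> carrier ?G" for X Y Z
  proof -
    obtain u v w where uvw: "u \<in> words S" "v \<in> words S" "w \<in> words S"
      and eqs: "X = word_cong S R `` {u}" "Y = word_cong S R `` {v}" "Z = word_cong S R `` {w}"
      using XYZ by (auto simp: car)
    moreover have "u @ v \<in> words S" "v @ w \<in> words S"
      using uvw by (auto simp: words_def)
    ultimately show ?thesis by (simp add: presented_group_mult)
  qed
  show "\<one>\<^bsub>?G\<^esub> \<otimes>\<^bsub>?G\<^esub> X = X" if X: "X \<in> carrier ?G" for X
  proof -
    have "[] \<in> words S" by (simp add: words_def)
    with X show ?thesis by (auto simp: car one presented_group_mult)
  qed
  show "\<exists>Y\<in>carrier ?G. Y \<otimes>\<^bsub>?G\<^esub> X = \<one>\<^bsub>?G\<^esub>" if X: "X \<in> carrier ?G" for X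
  proof -
    obtain u where u: "u \<in> words S" and X: "X = word_cong S R `` {u}"
      using X by (auto simp: car)
    let ?i = "rev (map (\<lambda>(x, b). (x, \<not> b)) u)"
    have i: "?i \<in> words S" using u by (auto simp: words_def)
    show ?thesis
    proof
      show "word_cong S R `` {?i} \<otimes>\<^bsub>?G\<^esub> X = \<one>\<^bsub>?G\<^esub>"
        unfolding X one presented_group_mult[OF i u]
        using equiv_class_eq[OF equiv_word_cong word_cong_inverse[OF u]] .
      show "word_cong S R `` {?i} \<in> carrier ?G" using i by (auto simp: car)
    qed
  qed
qed


datatype welded_gen = Alpha nat | Sigma nat

abbreviation \<alpha> :: "nat \<Rightarrow> welded_gen \<times> bool" where "\<alpha> i \<equiv> (Alpha i, True)"
abbreviation \<sigma> :: "nat \<Rightarrow> welded_gen \<times> bool" where "\<sigma> i \<equiv> (Sigma i, True)"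

definition welded_gens :: "nat \<Rightarrow> welded_gen set" where
  "welded_gens n = Alpha ` {1..n - 1} \<union> Sigma ` {1..n - 1}"

definition welded_rels :: "nat \<Rightarrow> (welded_gen word \<times> welded_gen word) set" where
  "welded_rels n =
    (\<Union>i\<in>{1..n - 1}. {([\<alpha> i, \<alpha> i], [])}) \<union>
    (\<Union>i\<in>{1..n - 1}. \<Union>j\<in>{j\<in>{1..n - 1}. \<bar>int i - int j\<bar> \<ge> 2}.
      {([\<alpha> i, \<alpha> j], [\<alpha> j, \<alpha> i]),
       ([\<sigma> i, \<sigma> j], [\<sigma> j, \<sigma> i]),
       ([\<alpha> i, \<sigma> j], [\<sigma> j, \<alpha> i])}) \<union>
    (\<Union>i\<in>{1..n - 2}.
      {([\<alpha> i, \<alpha> (i + 1), \<alpha> i], [\<alpha> (i + 1), \<alpha> i, \<alpha> (i + 1)]),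
       ([\<sigma> i, \<sigma> (i + 1), \<sigma> i], [\<sigma> (i + 1), \<sigma> i, \<sigma> (i + 1)]),
       ([\<alpha> i, \<alpha> (i + 1), \<sigma> i], [\<sigma> (i + 1), \<alpha> i, \<alpha> (i + 1)]),
       ([\<sigma> i, \<sigma> (i + 1), \<alpha> i], [\<alpha> (i + 1), \<sigma> i, \<sigma> (i + 1)])})"

definition welded_braid_group :: "nat \<Rightarrow> welded_gen word set monoid" where
  "welded_braid_group n = presented_group (welded_gens n) (welded_rels n)"

lemma group_welded_braid_group: "group (welded_braid_group n)"
  unfolding welded_braid_group_def by (rule group_presented_group)

lemma welded_rels_words: "welded_rels n \<subseteq> words (welded_gens n) \<times> words (welded_gens n)"
  by (auto simp: welded_rels_def words_def welded_gens_def)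


definition GL :: "(complex ^ 'r ^ 'r) monoid" where
  "GL = \<lparr>carrier = {A. invertible A}, mult = (**), one = mat 1\<rparr>"

lemma group_GL: "group GL"
proof (rule groupI)
  show "\<exists>B\<in>carrier GL. B \<otimes>\<^bsub>GL\<^esub> A = \<one>\<^bsub>GL\<^esub>" if "A \<in> carrier GL" for A :: "complex ^ 'r ^ 'r"
    using that by (auto simp: GL_def invertible_def)
  have "invertible (mat 1 :: complex ^ 'r ^ 'r)"
    by (auto simp: invertible_def intro!: exI[of _ "mat 1"])
  then show "\<one>\<^bsub>GL\<^esub> \<in> carrier (GL :: (complex ^ 'r ^ 'r) monoid)" by (simp add: GL_def)
qed (auto simp: GL_def invertible_mult matrix_mul_assoc)

text \<open>\<^term>\<open>vec.subspace\<close> is the notion of a complex-linear subspace of \<open>complex ^ 'r\<close>, unlike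
  \<^term>\<open>subspace\<close>, which is real-linear.\<close>

definition reducible_rep :: "('g, 'm) monoid_scheme \<Rightarrow> ('g \<Rightarrow> complex ^ 'r ^ 'r) \<Rightarrow> bool" where
  "reducible_rep G \<rho> \<longleftrightarrow>
    (\<exists>W. vec.subspace W \<and> W \<noteq> {0} \<and> W \<noteq> UNIV \<and> (\<forall>g\<in>carrier G. \<forall>w\<in>W. \<rho> g *v w \<in> W))"

end

theory Submission
  imports Defs "HOL-Computational_Algebra.Fundamental_Theorem_Algebra"
begin

text \<open>
The elements \<open>\<alpha>\<^sub>i\<close> satisfy the Coxeter relations of the symmetric group on \<open>n\<close> letters, and the
dimension \<open>r \<le> n - 2\<close> is too small for that group to act in a noncommutative way: apart from
characters, its irreducible representations have dimension at least \<open>n - 1\<close> when \<open>n \<ge> 5\<close>. Hence all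
\<open>\<alpha>\<^sub>i\<close> act by the same matrix \<open>a\<close>, and \<open>a\<^sup>2 = 1\<close>. The relation \<open>\<alpha>\<^sub>i \<alpha>\<^sub>i\<^sub>+\<^sub>1 \<sigma>\<^sub>i = \<sigma>\<^sub>i\<^sub>+\<^sub>1 \<alpha>\<^sub>i \<alpha>\<^sub>i\<^sub>+\<^sub>1\<close> then reads
\<open>\<sigma>\<^sub>i = \<sigma>\<^sub>i\<^sub>+\<^sub>1\<close>, so all \<open>\<sigma>\<^sub>i\<close> act by one matrix as well, which commutes with \<open>a\<close> because \<open>\<sigma>\<^sub>1\<close>
commutes with \<open>\<alpha>\<^sub>3\<close>. The image of \<open>\<rho>\<close> is therefore abelian, and commuting complex matrices in
dimension at least \<open>2\<close> share a proper invariant subspace (\<open>commuting_matrices_reducible\<close>).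

The fact on symmetric groups is proved without character theory or complete reducibility, in the form
that \<open>\<alpha>\<^sub>1\<close> and \<open>\<alpha>\<^sub>3\<close> agree on every space of dimension at most \<open>m - 2\<close> on which the symmetric group
on \<open>m \<ge> 4\<close> letters acts (\<open>symmetric_action_small_dim\<close>). In this form it holds for \<open>m = 4\<close> too,
where the two-dimensional irreducible representation is noncommutative but identifies \<open>\<alpha>\<^sub>1\<close> with
\<open>\<alpha>\<^sub>3\<close>; this makes an induction from \<open>m - 2\<close> to \<open>m\<close> possible. The eigenspaces of \<open>\<alpha>\<^sub>1\<close> for \<open>1\<close> and \<open>- 1\<close> are stable
under \<open>\<alpha>\<^sub>3, \<dots>, \<alpha>\<^sub>m\<^sub>-\<^sub>1\<close>, which generate a symmetric group on \<open>m - 2\<close> letters.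
If both eigenspaces have dimension at least \<open>2\<close>, then both have dimension at most \<open>m - 4\<close>, so by
induction \<open>\<alpha>\<^sub>3\<close> and \<open>\<alpha>\<^sub>5\<close> agree on each, hence everywhere; and an agreement of any two generators
forces one of \<open>\<alpha>\<^sub>1\<close> and \<open>\<alpha>\<^sub>3\<close> (\<open>agree_1_3\<close>). Otherwise \<open>\<alpha>\<^sub>1\<close>, up to sign, is the identity or a
reflection (\<open>reflection_agree_1_3\<close>). In the reflection case, if the generators are pairwise different,
their roots can be scaled so as to transform like the simple roots of type \<open>A\<^sub>m\<^sub>-\<^sub>1\<close>; these are linearly
independent because the Cartan matrix is invertible, and \<open>m - 1\<close> independent vectors do not fit.
\<close>

section \<open>Linear algebra preliminaries\<close>

text \<open>Linear independence of an indexed family bounds its length; the coefficients of a relation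
\<open>w i - w j = 0\<close> show that such a family has no repetitions, so that it has as many members as
indices.\<close>

lemma card_le_dim_if_coefficients_vanish:
  fixes w :: "'i \<Rightarrow> 'a::field ^ 'r"
  assumes I: "finite I" and V: "w ` I \<subseteq> V"
    and van: "\<And>c i. \<lbrakk>(\<Sum>i\<in>I. c i *s w i) = 0; i \<in> I\<rbrakk> \<Longrightarrow> c i = 0"
  shows "card I \<le> vec.dim V"
proof -
  have inj: "inj_on w I"
  proof (rule inj_onI, rule ccontr)
    fix i j assume ij: "i \<in> I" "j \<in> I" "w i = w j" "i \<noteq> j"
    let ?c = "\<lambda>k. (if k = i then 1 else 0) - (if k = j then 1 else 0) :: 'a"
    have "(\<Sum>k\<in>I. ?c k *s w k) = (\<Sum>k\<in>I. if k = i then w k else 0) - (\<Sum>k\<in>I. if k = j then w k else 0)"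
      unfolding sum_subtractf[symmetric] by (rule sum.cong) auto
    also have "\<dots> = 0"
      using I ij by simp
    finally have "?c i = 0"
      using ij(1) by (rule van)
    then show False
      using ij by simp
  qed
  have "vec.independent (w ` I)"
  proof (rule vec.independent_if_scalars_zero)
    fix f x assume "(\<Sum>x\<in>w ` I. f x *s x) = 0" "x \<in> w ` I"
    then show "f x = 0"
      using van[of "f \<circ> w"] by (auto simp: sum.reindex[OF inj])
  qed (use I in simp)
  then have "card (w ` I) \<le> vec.dim V"
    using V by (intro vec.independent_card_le_dim)
  then show ?thesis
    by (simp add: card_image[OF inj])
qed

lemma uminus_matrix_vector_mult: "(- A) *v v = - (A *v v)" for A :: "'a::ring_1 ^ 'n ^ 'm"
  using matrix_vector_mult_diff_rdistrib[of 0 A v] by (simp add: matrix_vector_mult_def vec_eq_iff)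

text \<open>The invertibility of the Cartan matrix of type \<open>A\<^sub>m\<^sub>-\<^sub>1\<close>: the recurrence makes \<open>c\<close> linear,
\<open>c k = k c 1\<close>, and then \<open>c m = 0\<close> forces \<open>c 1 = 0\<close> in characteristic zero.\<close>

lemma discrete_harmonic_zero:
  fixes c :: "nat \<Rightarrow> 'a::field_char_0"
  assumes zero: "c 0 = 0" "c m = 0"
    and harmonic: "\<And>j. \<lbrakk>1 \<le> j; j < m\<rbrakk> \<Longrightarrow> 2 * c j = c (j - 1) + c (Suc j)"
    and k: "k \<le> m"
  shows "c k = 0"
proof -
  have linear: "c k = of_nat k * c 1" if "k \<le> m" for k
    using that
  proof (induction k rule: less_induct)
    case (less k)
    consider "k = 0" | "k = 1" | l where "k = Suc (Suc l)"
      by (metis One_nat_def not0_implies_Suc)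
    then show ?case
    proof cases
      case 3
      then have "c k = 2 * c (Suc l) - c l"
        using harmonic[of "Suc l"] less.prems by (simp add: algebra_simps)
      also have "\<dots> = of_nat k * c 1"
        using less.IH[of l] less.IH[of "Suc l"] less.prems 3 by (simp add: algebra_simps)
      finally show ?thesis .
    qed (auto simp: zero)
  qed
  show ?thesis
  proof (cases "m = 0")
    case False
    then have "c 1 = 0"
      using linear[of m] zero by simp
    then show ?thesis
      using linear[OF k] by simp
  qed (use k zero in auto)
qed

section \<open>Coxeter relations of the symmetric group\<close>

text \<open>The generators \<open>A 1, \<dots>, A (m - 1)\<close> are matrices on the whole space, but the Coxeter
relations are required only on the subspace \<open>V\<close>. This allows an induction to pass to an eigenspace
without a change of basis.\<close>

locale symmetric_action =
  fixes m :: nat and A :: "nat \<Rightarrow> 'a::field_char_0 ^ 'r ^ 'r" and V :: "('a ^ 'r) set"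
  assumes subspace: "vec.subspace V"
    and closed: "\<lbrakk>1 \<le> i; i < m; v \<in> V\<rbrakk> \<Longrightarrow> A i *v v \<in> V"
    and involution: "\<lbrakk>1 \<le> i; i < m; v \<in> V\<rbrakk> \<Longrightarrow> A i *v (A i *v v) = v"
    and commute: "\<lbrakk>1 \<le> i; i + 2 \<le> j; j < m; v \<in> V\<rbrakk>
      \<Longrightarrow> A i *v (A j *v v) = A j *v (A i *v v)"
    and braid: "\<lbrakk>1 \<le> i; Suc i < m; v \<in> V\<rbrakk>
      \<Longrightarrow> A i *v (A (Suc i) *v (A i *v v)) = A (Suc i) *v (A i *v (A (Suc i) *v v))"
begin

definition agree :: "nat \<Rightarrow> nat \<Rightarrow> bool" where
  "agree i j \<longleftrightarrow> (\<forall>v\<in>V. A i *v v = A j *v v)"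

lemma agree_sym: "agree i j \<Longrightarrow> agree j i"
  and agree_trans: "agree i j \<Longrightarrow> agree j k \<Longrightarrow> agree i k"
  by (auto simp: agree_def)

text \<open>For commuting involutions \<open>s\<close> and \<open>t\<close> the braid relation \<open>sts = tst\<close> says \<open>t = s\<close>.\<close>

lemma agree_if_adjacent_commute:
  assumes i: "1 \<le> i" "Suc i < m"
    and c: "\<And>v. v \<in> V \<Longrightarrow> A i *v (A (Suc i) *v v) = A (Suc i) *v (A i *v v)"
  shows "agree i (Suc i)"
  unfolding agree_def
proof
  fix v assume v: "v \<in> V"
  have "A (Suc i) *v v = A i *v (A i *v (A (Suc i) *v v))"
    using i v by (simp add: involution closed)
  also have "\<dots> = A (Suc i) *v (A (Suc i) *v (A i *v v))"
    using i v braid[of i v] by (simp add: c)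
  also have "\<dots> = A i *v v"
    using i v by (simp add: involution closed)
  finally show "A i *v v = A (Suc i) *v v" ..
qed

text \<open>If \<open>A i\<close> agrees with some \<open>A j\<close> that is far away from \<open>A k\<close>, then \<open>A i\<close> commutes with its
neighbour \<open>A k\<close>, and two adjacent generators that commute agree. All later coincidences are propagated
in this way.\<close>

lemma agree_neighbour:
  assumes ij: "agree i j" and r: "1 \<le> i" "i < m" "1 \<le> j" "j < m" "1 \<le> k" "k < m"
    and jk: "j + 2 \<le> k \<or> k + 2 \<le> j" and ik: "k = Suc i \<or> i = Suc k"
  shows "agree i k"
proof -
  have c: "A i *v (A k *v v) = A k *v (A i *v v)" if v: "v \<in> V" for v
  proof -
    have "A i *v (A k *v v) = A j *v (A k *v v)"
      using ij r v closed[of k v] unfolding agree_def by blast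
    also have "\<dots> = A k *v (A j *v v)"
      using jk commute[of j k v] commute[of k j v] r v by auto
    also have "\<dots> = A k *v (A i *v v)"
      using ij v unfolding agree_def by simp
    finally show ?thesis .
  qed
  from ik show ?thesis
  proof
    assume k: "k = Suc i"
    show ?thesis
      unfolding k
    proof (rule agree_if_adjacent_commute)
      show "A i *v (A (Suc i) *v v) = A (Suc i) *v (A i *v v)" if "v \<in> V" for v
        using c[OF that] by (simp only: k)
    qed (use r k in auto)
  next
    assume i: "i = Suc k"
    have "agree k (Suc k)"
    proof (rule agree_if_adjacent_commute)
      show "A k *v (A (Suc k) *v v) = A (Suc k) *v (A k *v v)" if "v \<in> V" for v
        using c[OF that] by (simp only: i)
    qed (use r i in auto)
    then show ?thesis
      unfolding i by (rule agree_sym)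
  qed
qed

lemma agree_all_if_adjacent:
  assumes "1 \<le> i" "Suc i < m" "agree i (Suc i)" "1 \<le> k" "k < m"
  shows "agree 1 k"
proof -
  have "agree 1 2"
    using assms(1-3)
  proof (induction i rule: dec_induct)
    case base
    then show ?case by (simp add: numeral_2_eq_2)
  next
    case (step i)
    have "agree (Suc i) i"
      by (rule agree_neighbour[of _ "Suc (Suc i)"]) (use step in auto)
    then have "agree i (Suc i)"
      by (rule agree_sym)
    then show ?case
      using step by simp
  qed
  have adj: "agree j (Suc j)" if "1 \<le> j" "Suc j < m" for j
    using that
  proof (induction j rule: dec_induct)
    case base
    then show ?case using \<open>agree 1 2\<close> by (simp add: numeral_2_eq_2)
  next
    case (step j)
    show ?case
      by (rule agree_neighbour[of _ j]) (use step agree_sym[of j "Suc j"] in auto)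
  qed
  show ?thesis
    using assms(4,5)
  proof (induction k rule: dec_induct)
    case base
    then show ?case by (simp add: agree_def)
  next
    case (step k)
    then show ?case
      using adj[of k] agree_trans[of 1 k "Suc k"] by simp
  qed
qed

text \<open>Among the pairs of non-adjacent generators, only \<open>A 1, A 3\<close> for \<open>m = 4\<close> has no generator
adjacent to one member and far from the other. For \<open>m \<ge> 5\<close> any coincidence thus yields one of adjacent generators.\<close>

lemma agree_all:
  assumes m: "5 \<le> m" and ij: "1 \<le> i" "i < j" "j < m" "agree i j" and k: "1 \<le> k" "k < m"
  shows "agree 1 k"
proof -
  consider "j = Suc i" | "i + 2 \<le> j" "Suc j < m" | "i + 2 \<le> j" "1 < i"
    | "i = 1" "Suc j = m"
    using ij by linarith
  then have "\<exists>l. 1 \<le> l \<and> Suc l < m \<and> agree l (Suc l)"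
  proof cases
    case 1
    then show ?thesis using ij by auto
  next
    case 2
    have "agree j (Suc j)"
      by (rule agree_neighbour[of _ i]) (use 2 ij agree_sym[of i j] in auto)
    then show ?thesis using 2 ij by (intro exI[of _ j]) auto
  next
    case 3
    have "agree i (i - 1)"
      by (rule agree_neighbour[of _ j]) (use 3 ij in auto)
    then show ?thesis
      using 3 ij agree_sym[of i "i - 1"] by (intro exI[of _ "i - 1"]) auto
  next
    case 4
    have "agree i (Suc i)"
      by (rule agree_neighbour[of _ j]) (use 4 ij m in auto)
    then show ?thesis using 4 ij by (intro exI[of _ i]) auto
  qed
  then show ?thesis
    using agree_all_if_adjacent k by blast
qed

lemma agree_1_3:
  assumes "4 \<le> m" "1 \<le> i" "i < j" "j < m" "agree i j"
  shows "agree 1 3"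
proof (cases "5 \<le> m")
  case True
  then show ?thesis using agree_all assms by force
next
  case False
  then have "j = Suc i \<or> (i = 1 \<and> j = 3)"
    using assms by linarith
  then show ?thesis
    using agree_all_if_adjacent[of i 3] assms by auto
qed

section \<open>Reflections and their roots\<close>

text \<open>Two reflections with the same root \<open>w\<close> differ by a unipotent map: the product sends \<open>v\<close> to
\<open>v + (b - a) w\<close>, where \<open>a\<close> and \<open>b\<close> are the coefficients of \<open>v\<close>. The commutation or braid relation says
that its square or cube is the identity, so \<open>a = b\<close> in characteristic zero.\<close>

lemma agree_if_common_root:
  assumes ij: "1 \<le> i" "i < j" "j < m"
    and w: "w \<in> V" "w \<noteq> 0" "A i *v w = - w" "A j *v w = - w"
    and ri: "\<And>v. v \<in> V \<Longrightarrow> \<exists>c. A i *v v = v - c *s w"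
    and rj: "\<And>v. v \<in> V \<Longrightarrow> \<exists>c. A j *v v = v - c *s w"
  shows "agree i j"
  unfolding agree_def
proof
  fix v assume v: "v \<in> V"
  obtain a where a: "A i *v v = v - a *s w" using ri[OF v] by blast
  obtain b where b: "A j *v v = v - b *s w" using rj[OF v] by blast
  have iw: "A i *v (c *s w) = - (c *s w)" and jw: "A j *v (c *s w) = - (c *s w)" for c
    using w by (simp_all add: vec.scale vec.scale_minus_right)
  note simps = vec.diff vec.neg iw jw a b
  have "a = b"
  proof (cases "j = Suc i")
    case True
    have "A i *v (A j *v (A i *v v)) = A j *v (A i *v (A j *v v))"
      using braid[of i v] True ij v by simp
    then have "3 * (a - b) *s w = 0"
      by (auto simp add: simps algebra_simps vec_eq_iff)
    then show ?thesis
      using w by (auto simp: vec_eq_iff)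
  next
    case False
    have "A i *v (A j *v v) = A j *v (A i *v v)"
      using commute[of i j v] False ij v by simp
    then have "2 * (a - b) *s w = 0"
      by (auto simp add: simps algebra_simps vec_eq_iff)
    then show ?thesis
      using w by (auto simp: vec_eq_iff)
  qed
  then show "A i *v v = A j *v v"
    by (simp add: a b)
qed

text \<open>By the braid relation \<open>A i A (i + 1)\<close> conjugates \<open>A i\<close> into \<open>A (i + 1)\<close>, hence carries the
\<open>- 1\<close> eigenspace of the former onto that of the latter.\<close>

lemma root_transport:
  assumes i: "1 \<le> i" "Suc i < m"
    and w: "w \<in> V" "w \<noteq> 0" "A i *v w = - w"
    and line: "\<And>v. \<lbrakk>v \<in> V; A i *v v = - v\<rbrakk> \<Longrightarrow> \<exists>c. v = c *s w"
    and w': "w' = A i *v (A (Suc i) *v w)"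
  shows "w' \<in> V" "w' \<noteq> 0" "A (Suc i) *v w' = - w'"
    "\<And>v. \<lbrakk>v \<in> V; A (Suc i) *v v = - v\<rbrakk> \<Longrightarrow> \<exists>c. v = c *s w'"
    "A i *v w' = A (Suc i) *v w"
proof -
  have r: "1 \<le> i" "i < m" "1 \<le> Suc i" "Suc i < m"
    using i by auto
  show "w' \<in> V"
    using r w(1) unfolding w' by (intro closed)
  show iw': "A i *v w' = A (Suc i) *v w"
    unfolding w' using r w(1) by (intro involution closed)
  show "w' \<noteq> 0"
  proof
    assume "w' = 0"
    then have "A (Suc i) *v (A (Suc i) *v w) = 0"
      using iw' by simp
    then show False
      using involution[of "Suc i" w] r w by simp
  qed
  have "A (Suc i) *v w' = A i *v (A (Suc i) *v (A i *v w))"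
    unfolding w' using braid[OF i w(1)] by simp
  also have "\<dots> = - w'"
    by (simp only: w w' vec.neg)
  finally show "A (Suc i) *v w' = - w'" .
  show "\<exists>c. v = c *s w'" if v: "v \<in> V" "A (Suc i) *v v = - v" for v
  proof -
    let ?x = "A (Suc i) *v (A i *v v)"
    have "?x \<in> V"
      using r v(1) by (intro closed)
    moreover have "A i *v ?x = - ?x"
      using braid[OF i v(1)] by (simp only: v vec.neg)
    ultimately obtain c where c: "?x = c *s w"
      using line by blast
    have "v = A i *v (A (Suc i) *v ?x)"
      using involution[OF r(3,4) closed[OF r(1,2) v(1)]] involution[OF r(1,2) v(1)] by simp
    also have "\<dots> = c *s w'"
      by (simp only: c w' vec.scale)
    finally show ?thesis by blast
  qed
qed

text \<open>The hypotheses are the action of simple reflections on the simple roots of type \<open>A\<^sub>m\<^sub>-\<^sub>1\<close>.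
Applying \<open>A j\<close> to a linear relation changes it by \<open>c (j - 1) - 2 c j + c (j + 1)\<close> times \<open>w j\<close>, with
\<open>c 0 = c m = 0\<close>; this has to vanish.\<close>

lemma simple_roots_independent:
  assumes w: "\<And>i. \<lbrakk>1 \<le> i; i < m\<rbrakk> \<Longrightarrow> w i \<noteq> 0"
    and own: "\<And>i. \<lbrakk>1 \<le> i; i < m\<rbrakk> \<Longrightarrow> A i *v w i = - w i"
    and up: "\<And>i. \<lbrakk>1 \<le> i; Suc i < m\<rbrakk> \<Longrightarrow> A (Suc i) *v w i = w i + w (Suc i)"
    and down: "\<And>i. \<lbrakk>1 \<le> i; Suc i < m\<rbrakk> \<Longrightarrow> A i *v w (Suc i) = w i + w (Suc i)"
    and far: "\<And>i j. \<lbrakk>1 \<le> i; i < m; 1 \<le> j; j < m; i + 2 \<le> j \<or> j + 2 \<le> i\<rbrakk>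
      \<Longrightarrow> A j *v w i = w i"
    and sum: "(\<Sum>i = 1..<m. c i *s w i) = 0"
    and k: "1 \<le> k" "k < m"
  shows "c k = 0"
proof -
  \<comment> \<open>Cutting off \<open>c\<close> outside the index range supplies the boundary values \<open>0\<close> at \<open>0\<close> and \<open>m\<close>.\<close>
  define d where "d i = (if 1 \<le> i \<and> i < m then c i else 0)" for i
  have "2 * d j = d (j - 1) + d (Suc j)" if j: "1 \<le> j" "j < m" for j
  proof -
    \<comment> \<open>\<open>?t i\<close> is the coefficient of \<open>w j\<close> in \<open>A j (c i w i) - c i w i\<close>.\<close>
    let ?t = "\<lambda>i. if i = j then - 2 * d j else if Suc i = j then d (j - 1)
      else if i = Suc j then d (Suc j) else 0"
    have step: "A j *v (c i *s w i) = c i *s w i + ?t i *s w j" if i: "i \<in> {1..<m}" for i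
    proof -
      consider "i = j" | "Suc i = j" | "i = Suc j" | "i + 2 \<le> j \<or> j + 2 \<le> i"
        by linarith
      then show ?thesis
      proof cases
        case 1
        then show ?thesis
          using i by (simp add: vec.scale own d_def algebra_simps vec_eq_iff)
      next
        case 2
        then show ?thesis
          using i j up[of i] by (auto simp add: vec.scale d_def algebra_simps vec_eq_iff)
      next
        case 3
        then show ?thesis
          using i j down[of j] by (simp add: vec.scale d_def algebra_simps vec_eq_iff)
      next
        case 4
        then show ?thesis
          using i j far[of i j] by (auto simp add: vec.scale)
      qed
    qed
    have "0 = A j *v (\<Sum>i = 1..<m. c i *s w i)"
      by (simp only: sum vec.zero)
    also have "\<dots> = (\<Sum>i = 1..<m. c i *s w i + ?t i *s w j)"
      unfolding vec.sum by (rule sum.cong) (use step in auto)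
    also have "\<dots> = (\<Sum>i = 1..<m. ?t i) *s w j"
      using sum by (simp add: sum.distrib vec.scale_sum_left)
    also have "(\<Sum>i = 1..<m. ?t i) = d (j - 1) + d (Suc j) - 2 * d j"
    proof -
      have "(\<Sum>i = 1..<m. ?t i) = (\<Sum>i = 1..<m. (if i = j then - 2 * d j else 0)
        + (if i = j - 1 then d (j - 1) else 0) + (if i = Suc j then d (Suc j) else 0))"
        by (rule sum.cong) (use j in auto)
      also have "\<dots> = d (j - 1) + d (Suc j) - 2 * d j"
        using j by (auto simp: sum.distrib sum.delta d_def)
      finally show ?thesis .
    qed
    finally have "(d (j - 1) + d (Suc j) - 2 * d j) *s w j = 0" ..
    then have "d (j - 1) + d (Suc j) - 2 * d j = 0"
      using w[OF j] vec.scale_eq_0_iff by blast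
    then show ?thesis
      by (simp only: right_minus_eq)
  qed
  then have "d k = 0"
    by (rule discrete_harmonic_zero[of d m, rotated 2]) (use k in \<open>auto simp: d_def\<close>)
  then show ?thesis
    using k by (simp add: d_def)
qed

text \<open>If the two generators differed, all generators would be different reflections with different
root lines. Normalizing each root by transport from the previous one then makes the roots behave
like simple roots, and \<open>m - 1\<close> independent vectors exceed the dimension of \<open>V\<close>.\<close>

lemma reflection_agree_1_3:
  assumes m: "4 \<le> m" and dim: "vec.dim V + 2 \<le> m"
    and refl: "vec.dim {v \<in> V. A 1 *v v = - v} \<le> 1"
  shows "agree 1 3"
proof (rule ccontr)
  assume no: "\<not> agree 1 3"
  let ?E = "{v \<in> V. A 1 *v v = - v}"
  have differ: "\<not> agree i j" if "1 \<le> i" "i < m" "1 \<le> j" "j < m" "i \<noteq> j" for i j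
    using that no agree_1_3[OF m, of i j] agree_1_3[OF m, of j i] agree_sym[of i j]
    by (meson linorder_neqE_nat)
  \<comment> \<open>If \<open>A 1\<close> were the identity, it would commute with \<open>A 2\<close> and hence agree with it.\<close>
  obtain u where u: "u \<in> V" "u \<noteq> 0" "A 1 *v u = - u"
  proof (rule ccontr)
    assume "\<not> thesis"
    with that have none: "v = 0" if "v \<in> V" "A 1 *v v = - v" for v
      using that by blast
    have id: "A 1 *v v = v" if v: "v \<in> V" for v
    proof -
      have "v - A 1 *v v \<in> V"
        using m v by (intro vec.subspace_diff subspace closed) auto
      moreover have "A 1 *v (v - A 1 *v v) = - (v - A 1 *v v)"
        using involution[of 1 v] m v by (simp add: vec.diff)
      ultimately have "v - A 1 *v v = 0"
        by (rule none)
      then show ?thesis by simp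
    qed
    have "agree 1 (Suc 1)"
    proof (rule agree_if_adjacent_commute)
      show "A 1 *v (A (Suc 1) *v v) = A (Suc 1) *v (A 1 *v v)" if "v \<in> V" for v
        using id[OF that] id[OF closed[of "Suc 1" v]] m that by simp
    qed (use m in auto)
    then show False
      using differ[of 1 "Suc 1"] m by simp
  qed
  have line: "\<exists>c. v = c *s u" if v: "v \<in> V" "A 1 *v v = - v" for v
  proof -
    have "vec.independent {u}"
      using u by simp
    then have "?E \<subseteq> vec.span {u}"
      using u refl by (intro vec.card_ge_dim_independent) auto
    then show ?thesis
      using v by (auto simp: vec.span_singleton)
  qed
  \<comment> \<open>The value at \<open>0\<close> is a dummy; the roots are \<open>w 1, \<dots>, w (m - 1)\<close>.\<close>
  define w where "w = rec_nat (0::'a ^ 'r) (\<lambda>i x. if i = 0 then u else A i *v (A (Suc i) *v x))"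
  have w1: "w 1 = u" and wSuc: "w (Suc i) = A i *v (A (Suc i) *v w i)" if "1 \<le> i" for i
    using that by (auto simp: w_def)
  have root: "w i \<in> V \<and> w i \<noteq> 0 \<and> A i *v w i = - w i \<and>
      (\<forall>v\<in>V. A i *v v = - v \<longrightarrow> (\<exists>c. v = c *s w i))" if "1 \<le> i" "i < m" for i
    using that
  proof (induction i rule: dec_induct)
    case base
    then show ?case using u line w1[of 1] by auto
  next
    case (step i)
    then have IH: "w i \<in> V" "w i \<noteq> 0" "A i *v w i = - w i"
      "\<And>v. \<lbrakk>v \<in> V; A i *v v = - v\<rbrakk> \<Longrightarrow> \<exists>c. v = c *s w i"
      by auto
    show ?case
      using root_transport(1-4)[OF step(1) step(4) IH wSuc[OF step(1)]] by blast
  qed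
  have rank1: "\<exists>c. A i *v v = v - c *s w i" if i: "1 \<le> i" "i < m" and v: "v \<in> V" for i v
  proof -
    have "v - A i *v v \<in> V"
      using i v by (intro vec.subspace_diff subspace closed)
    moreover have "A i *v (v - A i *v v) = - (v - A i *v v)"
      using involution[OF i v] by (simp add: vec.diff)
    ultimately obtain c where "v - A i *v v = c *s w i"
      using root[OF i] by blast
    then have "A i *v v = v - c *s w i"
      by (simp add: algebra_simps)
    then show ?thesis ..
  qed
  have lines_differ: "A i *v w j \<noteq> - w j"
    if ij: "1 \<le> i" "i < m" "1 \<le> j" "j < m" "i \<noteq> j" for i j
  proof
    assume "A i *v w j = - w j"
    then obtain c where c: "w j = c *s w i"
      using root[of i] root[of j] ij by blast
    then have "c \<noteq> 0"
      using root[of j] ij by auto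
    then have wi: "w i = inverse c *s w j"
      by (simp add: c)
    have rank1': "\<exists>d. A i *v v = v - d *s w j" if v: "v \<in> V" for v
    proof -
      obtain d where "A i *v v = v - d *s w i"
        using rank1[OF ij(1,2) v] by blast
      then have "A i *v v = v - (d * inverse c) *s w j"
        by (simp add: wi)
      then show ?thesis ..
    qed
    have "agree i j \<or> agree j i"
    proof (cases "i < j")
      case True
      then show ?thesis
        using agree_if_common_root[of i j "w j"] ij root[of j] rank1[of j] rank1'
          \<open>A i *v w j = - w j\<close> by blast
    next
      case False
      then show ?thesis
        using agree_if_common_root[of j i "w j"] ij root[of j] rank1[of j] rank1'
          \<open>A i *v w j = - w j\<close> by force
    qed
    then show False
      using differ ij by blast
  qed
  have adjacent: "A (Suc i) *v w i = w i + w (Suc i)" "A i *v w (Suc i) = w i + w (Suc i)"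
    if i: "1 \<le> i" "Suc i < m" for i
  proof -
    obtain c where c: "A (Suc i) *v w i = w i - c *s w (Suc i)"
      using rank1[of "Suc i" "w i"] root[of i] i by auto
    have iw': "A i *v w (Suc i) = A (Suc i) *v w i"
      using root_transport(5)[OF i _ _ _ _ wSuc[OF i(1)]] root[of i] i by auto
    have "w (Suc i) = A i *v (w i - c *s w (Suc i))"
      using wSuc[OF i(1)] c by simp
    also have "\<dots> = - w i - c *s (w i - c *s w (Suc i))"
      using root[of i] i by (simp add: vec.diff vec.scale iw' c)
    \<comment> \<open>For \<open>c \<noteq> - 1\<close> this makes the two roots proportional, but their lines differ.\<close>
    finally have eq: "(1 + c) *s (w i + (1 - c) *s w (Suc i)) = 0"
      by (simp add: vec_eq_iff algebra_simps)
    have "c = - 1"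
    proof (rule ccontr)
      assume "c \<noteq> - 1"
      then have "1 + c \<noteq> 0"
        by (metis add.commute add_eq_0_iff)
      then have "w i + (1 - c) *s w (Suc i) = 0"
        using eq vec.scale_eq_0_iff by blast
      then have "w i = (c - 1) *s w (Suc i)"
        by (simp add: vec_eq_iff algebra_simps add_eq_0_iff)
      then have "A (Suc i) *v w i = - w i"
        using root[of "Suc i"] i by (simp add: vec.diff vec.scale vec.scale_minus_right)
      then show False
        using lines_differ[of "Suc i" i] i by simp
    qed
    then show "A (Suc i) *v w i = w i + w (Suc i)"
      using c by (simp add: vec_eq_iff)
    then show "A i *v w (Suc i) = w i + w (Suc i)"
      using iw' by simp
  qed
  have far: "A j *v w i = w i"
    if ij: "1 \<le> i" "i < m" "1 \<le> j" "j < m" "i + 2 \<le> j \<or> j + 2 \<le> i" for i j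
  proof -
    have "A i *v (A j *v w i) = A j *v (A i *v w i)"
      using commute[of i j "w i"] commute[of j i "w i"] ij root[of i] by auto
    also have "\<dots> = - (A j *v w i)"
      using root[of i] ij by (simp add: vec.neg)
    \<comment> \<open>Commuting with \<open>A i\<close>, the involution \<open>A j\<close> preserves the root line of \<open>A i\<close>, so it acts
      there by a sign.\<close>
    finally obtain c where c: "A j *v w i = c *s w i"
      using root[of i] closed[of j "w i"] ij by blast
    have "w i = A j *v (A j *v w i)"
      using involution[of j "w i"] root[of i] ij by simp
    also have "\<dots> = (c * c) *s w i"
      by (simp add: c vec.scale)
    finally have "(c * c - 1) *s w i = 0"
      by (simp add: vec_eq_iff algebra_simps)
    then have "c * c - 1 = 0"
      using root[of i] ij vec.scale_eq_0_iff by blast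
    then have "c * c = 1"
      by simp
    then have "c = 1 \<or> c = - 1"
      by (simp add: square_eq_1_iff)
    moreover have "c \<noteq> - 1"
      using lines_differ[of j i] ij c by (auto simp: vec_eq_iff)
    ultimately show ?thesis
      using c by simp
  qed
  have indep: "c k = 0" if "(\<Sum>i = 1..<m. c i *s w i) = 0" "1 \<le> k" "k < m" for c k
  proof (rule simple_roots_independent[of w c k])
    show "w i \<noteq> 0" "A i *v w i = - w i" if "1 \<le> i" "i < m" for i
      using root[OF that] by auto
  qed (fact adjacent far that)+
  have "w ` {1..<m} \<subseteq> V"
    using root by auto
  then have "card {1..<m} \<le> vec.dim V"
    by (rule card_le_dim_if_coefficients_vanish[rotated]) (use indep in auto)
  then show False
    using dim m by simp
qed

section \<open>Small representations of the symmetric group\<close>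

lemma symmetric_action_drop_two:
  assumes "vec.subspace W" "W \<subseteq> V"
    and "\<And>i v. \<lbrakk>3 \<le> i; i < m; v \<in> W\<rbrakk> \<Longrightarrow> A i *v v \<in> W"
  shows "symmetric_action (m - 2) (\<lambda>i. A (i + 2)) W"
proof
  fix i v assume i: "1 \<le> i" "i < m - 2" and v: "v \<in> W"
  show "A (i + 2) *v v \<in> W" "A (i + 2) *v (A (i + 2) *v v) = v"
    using assms(2,3) i v involution[of "i + 2" v] by auto
next
  fix i j v assume "1 \<le> i" "i + 2 \<le> j" "j < m - 2" "v \<in> W"
  then show "A (i + 2) *v (A (j + 2) *v v) = A (j + 2) *v (A (i + 2) *v v)"
    using assms(2) by (intro commute) auto
next
  fix i v assume "1 \<le> i" "Suc i < m - 2" "v \<in> W"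
  then show "A (i + 2) *v (A (Suc i + 2) *v (A (i + 2) *v v))
      = A (Suc i + 2) *v (A (i + 2) *v (A (Suc i + 2) *v v))"
    using assms(2) braid[of "i + 2" v] by auto
qed (use assms in auto)

text \<open>The tensor product with the sign character.\<close>

lemma symmetric_action_twist: "symmetric_action m (\<lambda>i. - A i) V"
  using closed involution commute braid subspace
  by unfold_locales (auto simp: uminus_matrix_vector_mult vec.neg vec.subspace_neg)

end

text \<open>Passing to the two eigenspaces of \<open>A 1\<close> loses two letters, and the bound on the dimension
drops by two as well as soon as neither eigenspace is at most a line. For \<open>m \<le> 5\<close> one of them always
is, since then \<open>V\<close> has dimension at most \<open>3\<close>; hence no separate base case occurs.\<close>

theorem symmetric_action_small_dim:
  assumes "symmetric_action m A V" "4 \<le> m" "vec.dim V + 2 \<le> m" "v \<in> V"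
  shows "A 1 *v v = A 3 *v v"
  using assms
proof (induction m arbitrary: A V v rule: less_induct)
  case (less m)
  interpret symmetric_action m A V by fact
  interpret twist: symmetric_action m "\<lambda>i. - A i" V by (rule symmetric_action_twist)
  note m = \<open>4 \<le> m\<close> and dim = \<open>vec.dim V + 2 \<le> m\<close>
  let ?P = "{v \<in> V. A 1 *v v = v}" and ?N = "{v \<in> V. A 1 *v v = - v}"
  have subP: "vec.subspace ?P" and subN: "vec.subspace ?N"
    using subspace by (auto simp: vec.subspace_def vec.add vec.scale vec.zero vec.scale_minus_right)
  have split: "\<exists>p n. p \<in> ?P \<and> n \<in> ?N \<and> v = p + n" if v: "v \<in> V" for v
  proof (intro exI conjI)
    let ?h = "inverse 2 :: 'a"
    have av: "A 1 *v v \<in> V" and aav: "A 1 *v (A 1 *v v) = v"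
      using v m by (auto intro: closed involution)
    show "?h *s (v + A 1 *v v) \<in> ?P"
      using v av aav subspace
      by (auto simp: vec.scale vec.add add.commute intro!: vec.subspace_scale vec.subspace_add)
    show "?h *s (v - A 1 *v v) \<in> ?N"
      using v av aav subspace
      by (auto simp: vec.scale vec.diff vec_eq_iff algebra_simps intro!: vec.subspace_scale vec.subspace_diff)
    show "v = ?h *s (v + A 1 *v v) + ?h *s (v - A 1 *v v)"
      by (simp add: vec_eq_iff field_simps)
  qed
  have "?P \<inter> ?N = {0}"
    using vec.subspace_0[OF subspace] by (auto simp: vec_eq_iff)
  moreover have "{p + n |p n. p \<in> ?P \<and> n \<in> ?N} = V"
    using split subspace by (auto intro: vec.subspace_add) blast
  ultimately have sum: "vec.dim V = vec.dim ?P + vec.dim ?N"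
    using vec.dim_sums_Int[OF subP subN] by simp
  consider "vec.dim ?N \<le> 1" | "vec.dim ?P \<le> 1" | "2 \<le> vec.dim ?N" "2 \<le> vec.dim ?P"
    by linarith
  then have "agree 1 3"
  proof cases
    case 1
    then show ?thesis by (intro reflection_agree_1_3 m dim)
  next
    case 2
    then have "twist.agree 1 3"
      by (intro twist.reflection_agree_1_3 m dim) (simp add: uminus_matrix_vector_mult)
    then show ?thesis
      by (simp add: agree_def twist.agree_def uminus_matrix_vector_mult)
  next
    case 3
    have inv: "A i *v v \<in> ?P" if "3 \<le> i" "i < m" "v \<in> ?P" for i v
      using that commute[of 1 i v] closed[of i v] by auto
    have inv': "A i *v v \<in> ?N" if "3 \<le> i" "i < m" "v \<in> ?N" for i v
      using that commute[of 1 i v] closed[of i v] by (auto simp: vec.neg)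
    have P: "A 3 *v v = A 5 *v v" if "v \<in> ?P" for v
      using less.IH[OF _ symmetric_action_drop_two[OF subP _ inv], of v] that 3 sum dim
      by (simp add: numeral_eq_Suc)
    have N: "A 3 *v v = A 5 *v v" if "v \<in> ?N" for v
      using less.IH[OF _ symmetric_action_drop_two[OF subN _ inv'], of v] that 3 sum dim
      by (simp add: numeral_eq_Suc)
    have "agree 3 5"
      unfolding agree_def
    proof
      fix v assume "v \<in> V"
      then obtain p n where "p \<in> ?P" "n \<in> ?N" "v = p + n"
        using split by blast
      then show "A 3 *v v = A 5 *v v"
        using P N by (simp add: vec.add)
    qed
    then show ?thesis
      using agree_1_3[OF m, of 3 5] 3 sum dim by simp
  qed
  then show ?case
    using less.prems(4) by (simp add: agree_def)
qed

section \<open>Commuting complex matrices\<close>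

text \<open>Horner evaluation of \<open>p(B) v\<close>.\<close>

definition poly_act :: "'a::field poly \<Rightarrow> 'a ^ 'r ^ 'r \<Rightarrow> 'a ^ 'r \<Rightarrow> 'a ^ 'r" where
  "poly_act p B v = fold_coeffs (\<lambda>a w. a *s v + B *v w) p 0"

lemma poly_act_0 [simp]: "poly_act 0 B v = 0"
  by (simp add: poly_act_def)

lemma poly_act_pCons [simp]: "poly_act (pCons a p) B v = a *s v + B *v poly_act p B v"
  by (cases "p = 0 \<and> a = 0") (auto simp: poly_act_def)

lemma poly_act_add: "poly_act (p + q) B v = poly_act p B v + poly_act q B v"
  by (induction p q rule: poly_induct2) (simp_all add: vec.add algebra_simps)

lemma poly_act_smult: "poly_act (smult c p) B v = c *s poly_act p B v"
  by (induction p) (simp_all add: vec.scale vec.scale_right_distrib)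

lemma poly_act_sum: "poly_act (\<Sum>i\<in>I. p i) B v = (\<Sum>i\<in>I. poly_act (p i) B v)"
  by (induction I rule: infinite_finite_induct) (simp_all add: poly_act_add)

lemma poly_act_linear_factor:
  "poly_act ([:- z, 1:] * q) B v = B *v poly_act q B v - z *s poly_act q B v"
proof -
  have "[:- z, 1:] * q = smult (- z) q + pCons 0 q"
    by simp
  then show ?thesis
    by (simp only: poly_act_add poly_act_smult poly_act_pCons) simp
qed

text \<open>The \<open>r + 1\<close> vectors \<open>v, B v, \<dots>, B\<^sup>r v\<close> in an \<open>r\<close>-dimensional space satisfy a linear relation.\<close>

lemma exists_annihilating_poly: "\<exists>p. p \<noteq> 0 \<and> poly_act p B v = 0"
  for B :: "'a::field ^ 'r ^ 'r"
proof (rule ccontr)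
  assume no: "\<not> ?thesis"
  have "card {..CARD('r)} \<le> vec.dim (UNIV :: ('a ^ 'r) set)"
  proof (rule card_le_dim_if_coefficients_vanish)
    fix c i assume s: "(\<Sum>i\<le>CARD('r). c i *s poly_act (monom 1 i) B v) = 0" and i: "i \<in> {..CARD('r)}"
    let ?p = "\<Sum>i\<le>CARD('r). monom (c i) i"
    have "poly_act ?p B v = (\<Sum>i\<le>CARD('r). poly_act (smult (c i) (monom 1 i)) B v)"
      by (simp add: poly_act_sum smult_monom)
    also have "\<dots> = 0"
      using s by (simp add: poly_act_smult del: smult_monom)
    finally have "?p = 0"
      using no by blast
    then have "coeff ?p i = 0"
      by simp
    then show "c i = 0"
      using i by (simp add: coeff_sum)
  qed auto
  then show False
    by (simp add: vec_dim_card del: vec.dim_UNIV)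
qed

text \<open>Splitting a linear factor \<open>X - z\<close> off an annihilating polynomial of minimal degree for some
\<open>u \<noteq> 0\<close> leaves \<open>q\<close> with \<open>q(B) u \<noteq> 0\<close>, and this vector is an eigenvector for \<open>z\<close>.\<close>

lemma exists_eigenvector:
  fixes B :: "complex ^ 'r ^ 'r"
  shows "\<exists>z v. v \<noteq> 0 \<and> B *v v = z *s v"
proof -
  define u :: "complex ^ 'r" where "u = 1"
  have u: "u \<noteq> 0"
    by (simp add: u_def vec_eq_iff)
  define p where "p = arg_min degree (\<lambda>p. p \<noteq> 0 \<and> poly_act p B u = 0)"
  have p: "p \<noteq> 0" "poly_act p B u = 0"
    and min: "\<And>q. \<lbrakk>q \<noteq> 0; poly_act q B u = 0\<rbrakk> \<Longrightarrow> degree p \<le> degree q"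
    using arg_min_nat_lemma[of "\<lambda>p. p \<noteq> 0 \<and> poly_act p B u = 0" _ degree]
      exists_annihilating_poly[of B u] unfolding p_def by blast+
  have "degree p \<noteq> 0"
  proof
    assume "degree p = 0"
    then obtain a where "p = [:a:]"
      by (rule degree_eq_zeroE)
    then show False
      using p u by simp
  qed
  then obtain z where "poly p z = 0"
    using fundamental_theorem_of_algebra[of p] constant_degree[of p] by auto
  then obtain q where q: "p = [:- z, 1:] * q"
    by (auto simp: poly_eq_0_iff_dvd elim: dvdE)
  have "q \<noteq> 0"
    using p q by auto
  then have "degree p = Suc (degree q)"
    unfolding q by (subst degree_mult_eq) auto
  then have "poly_act q B u \<noteq> 0"
    using min[of q] \<open>q \<noteq> 0\<close> by auto
  moreover have "B *v poly_act q B u = z *s poly_act q B u"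
    using p(2) unfolding q poly_act_linear_factor by simp
  ultimately show ?thesis by blast
qed

text \<open>Any eigenspace of one of the matrices is stable under the others. It is proper unless the matrix
is scalar, and if all matrices are scalar then any line will do.\<close>

lemma commuting_matrices_reducible:
  fixes M :: "(complex ^ 'r ^ 'r) set"
  assumes dim: "2 \<le> CARD('r)"
    and commute: "\<And>X Y. \<lbrakk>X \<in> M; Y \<in> M\<rbrakk> \<Longrightarrow> X ** Y = Y ** X"
  shows "\<exists>W. vec.subspace W \<and> W \<noteq> {0} \<and> W \<noteq> UNIV \<and> (\<forall>X\<in>M. \<forall>w\<in>W. X *v w \<in> W)"
proof (cases "\<forall>X\<in>M. \<exists>z. \<forall>v. X *v v = z *s v")
  case True
  let ?W = "vec.span {1 :: complex ^ 'r}"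
  have "vec.dim ?W \<noteq> vec.dim (UNIV :: (complex ^ 'r) set)"
    using dim unfolding vec.dim_span vec.dim_singleton vec_dim_card by simp
  then have "?W \<noteq> UNIV" by metis
  moreover have "1 \<in> ?W" "(1 :: complex ^ 'r) \<noteq> 0"
    by (auto intro: vec.span_base simp: vec_eq_iff)
  then have "?W \<noteq> {0}" by blast
  moreover have "X *v w \<in> ?W" if "X \<in> M" "w \<in> ?W" for X w
    using True that vec.span_scale by metis
  ultimately show ?thesis
    by (intro exI[of _ ?W]) auto
next
  case False
  then obtain X where X: "X \<in> M" "\<And>z. \<exists>v. X *v v \<noteq> z *s v"
    by blast
  obtain z v where v: "v \<noteq> 0" "X *v v = z *s v"
    using exists_eigenvector by blast
  let ?W = "{w. X *v w = z *s w}"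
  have "vec.subspace ?W"
    by (auto simp: vec.subspace_def vec.add vec.scale vec.scale_right_distrib mult.commute)
  moreover have "?W \<noteq> {0}" "?W \<noteq> UNIV"
    using v X(2)[of z] by blast+
  moreover have "Y *v w \<in> ?W" if "Y \<in> M" "w \<in> ?W" for Y w
  proof -
    have "X *v (Y *v w) = Y *v (X *v w)"
      using commute[OF X(1) that(1)] by (simp add: matrix_vector_mul_assoc)
    then show ?thesis
      using that(2) by (simp add: vec.scale)
  qed
  ultimately show ?thesis by blast
qed

section \<open>Homomorphisms from presented groups\<close>

definition generator :: "'a set \<Rightarrow> ('a word \<times> 'a word) set \<Rightarrow> 'a \<Rightarrow> 'a word set" where
  "generator S R x = word_cong S R `` {[(x, True)]}"

lemma carrier_presented_group:
  "carrier (presented_group S R) = (\<lambda>u. word_cong S R `` {u}) ` words S"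
  by (auto simp: presented_group_def quotient_def)

lemma generator_closed: "x \<in> S \<Longrightarrow> generator S R x \<in> carrier (presented_group S R)"
  by (auto simp: carrier_presented_group generator_def words_def)

lemma class_Nil: "word_cong S R `` {[]} = \<one>\<^bsub>presented_group S R\<^esub>"
  by (simp add: presented_group_def)

lemma class_Cons_True:
  assumes "x \<in> S" "u \<in> words S"
  shows "word_cong S R `` {(x, True) # u} =
    generator S R x \<otimes>\<^bsub>presented_group S R\<^esub> word_cong S R `` {u}"
  using presented_group_mult[of "[(x, True)]" S u R] assms by (simp add: generator_def words_def)

lemma class_Cons_False:
  assumes "x \<in> S" "u \<in> words S"
  shows "word_cong S R `` {(x, False) # u} =
    inv\<^bsub>presented_group S R\<^esub> generator S R x \<otimes>\<^bsub>presented_group S R\<^esub> word_cong S R `` {u}"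
proof -
  interpret group "presented_group S R" by (rule group_presented_group)
  have w: "[(x, False)] \<in> words S" "[(x, True)] \<in> words S" "[] \<in> words S"
    using assms by (auto simp: words_def)
  have "([(x, False), (x, True)], []) \<in> word_cong S R"
    using word_cong.cancel[OF w(3,3) assms(1), of False R] by simp
  then have "word_cong S R `` {[(x, False)]} \<otimes>\<^bsub>presented_group S R\<^esub> generator S R x = \<one>\<^bsub>presented_group S R\<^esub>"
    unfolding generator_def presented_group_mult[OF w(1,2)] class_Nil[symmetric]
    using equiv_class_eq[OF equiv_word_cong] by force
  moreover have "word_cong S R `` {[(x, False)]} \<in> carrier (presented_group S R)"
    using w by (simp add: carrier_presented_group)
  ultimately have "inv\<^bsub>presented_group S R\<^esub> generator S R x = word_cong S R `` {[(x, False)]}"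
    using inv_equality generator_closed[OF assms(1)] by blast
  then show ?thesis
    using presented_group_mult[OF w(1) assms(2), of R] by simp
qed

lemma class_eq_if_relation:
  assumes "(l, r) \<in> R" "l \<in> words S" "r \<in> words S"
  shows "word_cong S R `` {l} = word_cong S R `` {r}"
proof (rule equiv_class_eq[OF equiv_word_cong])
  show "(l, r) \<in> word_cong S R"
    using word_cong.rel[of "[]" S "[]" l r R] assms by (simp add: words_def)
qed

lemma presented_group_induct [consumes 1, case_names one generator inverse]:
  fixes S R
  defines "G \<equiv> presented_group S R"
  assumes g: "g \<in> carrier G"
    and one: "P \<one>\<^bsub>G\<^esub>"
    and gen: "\<And>x h. \<lbrakk>x \<in> S; h \<in> carrier G; P h\<rbrakk> \<Longrightarrow> P (generator S R x \<otimes>\<^bsub>G\<^esub> h)"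
    and inv: "\<And>x h. \<lbrakk>x \<in> S; h \<in> carrier G; P h\<rbrakk> \<Longrightarrow> P (inv\<^bsub>G\<^esub> generator S R x \<otimes>\<^bsub>G\<^esub> h)"
  shows "P g"
proof -
  obtain u where u: "u \<in> words S" "g = word_cong S R `` {u}"
    using g by (auto simp: G_def carrier_presented_group)
  have "P (word_cong S R `` {u})"
    using u(1)
  proof (induction u)
    case Nil
    then show ?case using one by (simp add: G_def class_Nil)
  next
    case (Cons a u)
    then obtain x b where a: "a = (x, b)" "x \<in> S" and w: "u \<in> words S"
      by (cases a) (auto simp: words_def)
    then have "word_cong S R `` {u} \<in> carrier G" "P (word_cong S R `` {u})"
      using Cons by (auto simp: G_def carrier_presented_group)
    then show ?case
      using a w gen inv by (cases b) (auto simp: G_def class_Cons_True class_Cons_False)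
  qed
  then show ?thesis by (simp add: u)
qed

text \<open>The elements that commute with \<open>X\<close> form a subgroup.\<close>

lemma hom_commute_if_generators_commute:
  assumes H: "group H" and hom: "\<rho> \<in> hom (presented_group S R) H" and X: "X \<in> carrier H"
    and gen: "\<And>x. x \<in> S \<Longrightarrow> X \<otimes>\<^bsub>H\<^esub> \<rho> (generator S R x) = \<rho> (generator S R x) \<otimes>\<^bsub>H\<^esub> X"
    and g: "g \<in> carrier (presented_group S R)"
  shows "X \<otimes>\<^bsub>H\<^esub> \<rho> g = \<rho> g \<otimes>\<^bsub>H\<^esub> X"
proof -
  interpret group_hom "presented_group S R" H \<rho>
    using H hom group_presented_group by (auto simp: group_hom_def group_hom_axioms_def)
  have mult_commutes: "X \<otimes>\<^bsub>H\<^esub> (y \<otimes>\<^bsub>H\<^esub> z) = (y \<otimes>\<^bsub>H\<^esub> z) \<otimes>\<^bsub>H\<^esub> X"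
    if "y \<in> carrier H" "z \<in> carrier H" "X \<otimes>\<^bsub>H\<^esub> y = y \<otimes>\<^bsub>H\<^esub> X" "X \<otimes>\<^bsub>H\<^esub> z = z \<otimes>\<^bsub>H\<^esub> X" for y z
    using that X by (metis H.m_assoc)
  have inv_commutes: "X \<otimes>\<^bsub>H\<^esub> inv\<^bsub>H\<^esub> y = inv\<^bsub>H\<^esub> y \<otimes>\<^bsub>H\<^esub> X"
    if "y \<in> carrier H" "X \<otimes>\<^bsub>H\<^esub> y = y \<otimes>\<^bsub>H\<^esub> X" for y
    using that X by (metis H.inv_closed H.inv_solve_left H.inv_solve_right H.m_assoc H.m_closed)
  from g show ?thesis
  proof (induction rule: presented_group_induct)
    case one
    then show ?case using X by simp
  next
    case (generator x h)
    then show ?case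
      using gen generator_closed[of x S R] by (simp add: mult_commutes)
  next
    case (inverse x h)
    then show ?case
      using gen generator_closed[of x S R] by (simp add: mult_commutes inv_commutes)
  qed
qed

text \<open>The centralizer argument is used twice: first with \<open>X\<close> the image of a generator, to see that
\<open>\<rho> g\<close> commutes with it, and then with \<open>X = \<rho> g\<close>.\<close>

lemma hom_image_commute_if_generators_commute:
  assumes H: "group H" and hom: "\<rho> \<in> hom (presented_group S R) H"
    and gen: "\<And>x y. \<lbrakk>x \<in> S; y \<in> S\<rbrakk> \<Longrightarrow> \<rho> (generator S R x) \<otimes>\<^bsub>H\<^esub> \<rho> (generator S R y)
      = \<rho> (generator S R y) \<otimes>\<^bsub>H\<^esub> \<rho> (generator S R x)"
    and g: "g \<in> carrier (presented_group S R)" "h \<in> carrier (presented_group S R)"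
  shows "\<rho> g \<otimes>\<^bsub>H\<^esub> \<rho> h = \<rho> h \<otimes>\<^bsub>H\<^esub> \<rho> g"
proof (rule hom_commute_if_generators_commute[OF H hom _ _ g(2)])
  show "\<rho> g \<in> carrier H"
    using hom g(1) by (rule hom_in_carrier)
  show "\<rho> g \<otimes>\<^bsub>H\<^esub> \<rho> (generator S R x) = \<rho> (generator S R x) \<otimes>\<^bsub>H\<^esub> \<rho> g" if x: "x \<in> S" for x
    by (rule hom_commute_if_generators_commute[OF H hom _ _ g(1), symmetric])
      (use gen x hom in \<open>auto intro: hom_in_carrier generator_closed\<close>)
qed

section \<open>Representations of the welded braid group\<close>

theorem theorem6p1:
  fixes n :: nat
    and \<rho> :: "welded_gen word set \<Rightarrow> complex ^ 'r ^ 'r"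
  assumes "n \<ge> 5"
    and "2 \<le> CARD('r)" and "CARD('r) \<le> n - 2"
    and "\<rho> \<in> hom (welded_braid_group n) GL"
  shows "reducible_rep (welded_braid_group n) \<rho>"
proof -
  let ?S = "welded_gens n" and ?R = "welded_rels n"
  let ?G = "presented_group ?S ?R"
  let ?c = "\<lambda>u. word_cong ?S ?R `` {u}"
  have hom: "\<rho> \<in> hom ?G GL"
    using assms(4) by (simp add: welded_braid_group_def)
  interpret group_hom ?G "GL :: (complex ^ 'r ^ 'r) monoid" \<rho>
    using hom group_GL group_presented_group by (auto simp: group_hom_def group_hom_axioms_def)
  define a where "a i = \<rho> (generator ?S ?R (Alpha i))" for i
  define s where "s i = \<rho> (generator ?S ?R (Sigma i))" for i
  have Cons: "\<rho> (?c ((x, True) # u)) = \<rho> (generator ?S ?R x) ** \<rho> (?c u)" if "x \<in> ?S" "u \<in> words ?S" for x u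
  proof -
    have "?c u \<in> carrier ?G"
      using that by (simp add: carrier_presented_group)
    then show ?thesis
      using that hom_mult[of "generator ?S ?R x" "?c u"] generator_closed[of x ?S ?R]
      by (simp add: class_Cons_True GL_def)
  qed
  have Nil: "\<rho> (?c []) = mat 1"
    using hom_one by (simp add: class_Nil GL_def)
  have rel: "\<rho> (?c l) = \<rho> (?c r)" if "(l, r) \<in> ?R" for l r
    using class_eq_if_relation[OF that] that welded_rels_words[of n] by fastforce
  have mem: "Alpha i \<in> ?S \<longleftrightarrow> 1 \<le> i \<and> i < n" "Sigma i \<in> ?S \<longleftrightarrow> 1 \<le> i \<and> i < n" for i
    by (auto simp: welded_gens_def)
  have word: "(x, b) # u \<in> words ?S \<longleftrightarrow> x \<in> ?S \<and> u \<in> words ?S" "[] \<in> words ?S" for x b u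
    by (auto simp: words_def)
  note eval = Cons Nil word mem a_def[symmetric] s_def[symmetric]
  have aa: "a i ** a i = mat 1" if "1 \<le> i" "i < n" for i
  proof -
    have "([\<alpha> i, \<alpha> i], []) \<in> ?R"
      using that by (auto simp: welded_rels_def)
    from rel[OF this] that show ?thesis by (simp add: eval)
  qed
  have far: "a i ** a j = a j ** a i" "a i ** s j = s j ** a i"
    if "1 \<le> i" "i < n" "1 \<le> j" "j < n" "i + 2 \<le> j \<or> j + 2 \<le> i" for i j
  proof -
    have d: "i \<in> {1..n - 1}" "j \<in> {j\<in>{1..n - 1}. \<bar>int i - int j\<bar> \<ge> 2}"
      using that by auto
    have "([\<alpha> i, \<alpha> j], [\<alpha> j, \<alpha> i]) \<in> ?R" "([\<alpha> i, \<sigma> j], [\<sigma> j, \<alpha> i]) \<in> ?R"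
      using d unfolding welded_rels_def by blast+
    from this[THEN rel] that show "a i ** a j = a j ** a i" "a i ** s j = s j ** a i"
      by (simp_all add: eval)
  qed
  have near: "a i ** (a (Suc i) ** a i) = a (Suc i) ** (a i ** a (Suc i))"
      "a i ** (a (Suc i) ** s i) = s (Suc i) ** (a i ** a (Suc i))"
    if "1 \<le> i" "Suc i < n" for i
  proof -
    have d: "i \<in> {1..n - 2}"
      using that by auto
    have "([\<alpha> i, \<alpha> (i + 1), \<alpha> i], [\<alpha> (i + 1), \<alpha> i, \<alpha> (i + 1)]) \<in> ?R"
      "([\<alpha> i, \<alpha> (i + 1), \<sigma> i], [\<sigma> (i + 1), \<alpha> i, \<alpha> (i + 1)]) \<in> ?R"
      using d unfolding welded_rels_def by blast+
    from this[THEN rel] that show "a i ** (a (Suc i) ** a i) = a (Suc i) ** (a i ** a (Suc i))"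
      "a i ** (a (Suc i) ** s i) = s (Suc i) ** (a i ** a (Suc i))"
      by (simp_all add: eval)
  qed
  interpret symmetric_action n a UNIV
  proof
    fix i j and v :: "complex ^ 'r"
    show "1 \<le> i \<Longrightarrow> i < n \<Longrightarrow> a i *v (a i *v v) = v"
      using aa by (simp add: matrix_vector_mul_assoc)
    show "1 \<le> i \<Longrightarrow> i + 2 \<le> j \<Longrightarrow> j < n \<Longrightarrow> a i *v (a j *v v) = a j *v (a i *v v)"
      using far(1)[of i j] by (simp add: matrix_vector_mul_assoc)
    show "1 \<le> i \<Longrightarrow> Suc i < n \<Longrightarrow> a i *v (a (Suc i) *v (a i *v v)) = a (Suc i) *v (a i *v (a (Suc i) *v v))"
      using near(1)[of i] by (simp add: matrix_vector_mul_assoc matrix_mul_assoc)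
  qed auto
  have "agree 1 3"
    unfolding agree_def
    using symmetric_action_small_dim[OF symmetric_action_axioms] assms by (auto simp: vec_dim_card simp del: vec.dim_UNIV)
  then have "agree 1 i" if "1 \<le> i" "i < n" for i
    using agree_all[of 1 3 i] assms(1) that by simp
  then have a_eq: "a i = a 1" if "1 \<le> i" "i < n" for i
    using that by (simp add: agree_def matrix_eq)
  \<comment> \<open>With equal involutions \<open>a i\<close>, the mixed relation reduces to \<open>s i = s (Suc i)\<close>.\<close>
  have s_eq: "s i = s 1" if "1 \<le> i" "i < n" for i
    using that
  proof (induction i rule: dec_induct)
    case (step i)
    then have "s i = s (Suc i)"
      using near(2)[of i] aa[of 1]
      by (simp add: a_eq[of i] a_eq[of "Suc i"] flip: matrix_mul_assoc) (simp add: matrix_mul_assoc)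
    then show ?case
      using step by simp
  qed simp
  have as: "a 1 ** s 1 = s 1 ** a 1"
    using far(2)[of 3 1] a_eq[of 3] assms(1) by simp
  have img: "\<rho> (generator ?S ?R x) \<in> {a 1, s 1}" if "x \<in> ?S" for x
  proof (cases x)
    case (Alpha i)
    then show ?thesis
      using that mem a_eq[of i] by (simp flip: a_def)
  next
    case (Sigma i)
    then show ?thesis
      using that mem s_eq[of i] by (simp flip: s_def)
  qed
  have "\<rho> g ** \<rho> h = \<rho> h ** \<rho> g" if "g \<in> carrier ?G" "h \<in> carrier ?G" for g h
  proof -
    have "\<rho> (generator ?S ?R x) ** \<rho> (generator ?S ?R y) = \<rho> (generator ?S ?R y) ** \<rho> (generator ?S ?R x)"
      if "x \<in> ?S" "y \<in> ?S" for x y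
      using img[OF that(1)] img[OF that(2)] as by auto
    then show ?thesis
      using hom_image_commute_if_generators_commute[OF group_GL hom _ that] by (simp add: GL_def)
  qed
  then have "\<exists>W. vec.subspace W \<and> W \<noteq> {0} \<and> W \<noteq> UNIV \<and> (\<forall>X\<in>\<rho> ` carrier ?G. \<forall>w\<in>W. X *v w \<in> W)"
    by (intro commuting_matrices_reducible assms(2)) blast
  then show ?thesis
    by (simp add: reducible_rep_def welded_braid_group_def)
qed

end
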